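(* The subspace $$M^{1}=\left\{x\in L^{1}\ :\ \int_{0}^{1}x(t)\,dt=0\right\}\subset L^{1},$$ equipped with the norm of $L^1$, is almost transitive.
   Context: All Banach spaces are real; $L^1=L^1([0,1])$ is the space of real-valued Lebesgue integrable functions on $[0,1]$ with Lebesgue measure and its usual norm. For a Banach space $E$, let $\mathbf{S}_E$ be its unit sphere and $\mathcal{G}_E$ the group of isometric automorphisms (surjective linear isometries) $T\colon E\to E$; for $x\in E$ write $\mathcal{G}_E(x)=\{T(x): T\in\mathcal{G}_E\}$. The space $E$ is called almost transitive if $\overline{\mathcal{G}_E(x)}=\mathbf{S}_E$ (norm closure) for every $x\in\mathbf{S}_E$. *)

theory Defs
  imports "HOL-Analysis.Analysis"
begin

abbreviation unit_interval_measure :: "real measure" where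
  "unit_interval_measure \<equiv> lebesgue_on {0..1}"

text \<open>
  A partial quotient: only integrable functions represent elements, and two of them represent the
  same element iff they agree almost everywhere on the unit interval. Representatives are
  total functions on the reals, but their values outside the interval are irrelevant.
\<close>

definition L1_rel :: "(real \<Rightarrow> real) \<Rightarrow> (real \<Rightarrow> real) \<Rightarrow> bool" where
  "L1_rel f g \<longleftrightarrow> integrable unit_interval_measure f \<and> integrable unit_interval_measure g
     \<and> (AE t in unit_interval_measure. f t = g t)"

quotient_type L1 = "real \<Rightarrow> real" / partial: L1_rel
proof (rule part_equivpI)
  show "\<exists>f. L1_rel f f"
    by (rule exI[of _ "\<lambda>_. 0"]) (simp add: L1_rel_def)
  show "symp L1_rel"
    by (auto simp: symp_def L1_rel_def)
  show "transp L1_rel"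
    by (auto simp: transp_def L1_rel_def elim: AE_mp)
qed

instantiation L1 :: real_normed_vector
begin

lift_definition zero_L1 :: L1 is "\<lambda>_. 0"
  by (simp add: L1_rel_def)

lift_definition plus_L1 :: "L1 \<Rightarrow> L1 \<Rightarrow> L1" is "\<lambda>f g t. f t + g t"
  by (auto simp: L1_rel_def)

lift_definition minus_L1 :: "L1 \<Rightarrow> L1 \<Rightarrow> L1" is "\<lambda>f g t. f t - g t"
  by (auto simp: L1_rel_def)

lift_definition uminus_L1 :: "L1 \<Rightarrow> L1" is "\<lambda>f t. - f t"
  by (auto simp: L1_rel_def)

lift_definition scaleR_L1 :: "real \<Rightarrow> L1 \<Rightarrow> L1" is "\<lambda>c f t. c * f t"
  by (auto simp: L1_rel_def)

lift_definition norm_L1 :: "L1 \<Rightarrow> real" is "\<lambda>f. \<integral>t. \<bar>f t\<bar> \<partial>unit_interval_measure"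
  by (rule integral_cong_AE) (auto simp: L1_rel_def)

definition dist_L1 :: "L1 \<Rightarrow> L1 \<Rightarrow> real" where
  "dist_L1 x y = norm (x - y)"

definition sgn_L1 :: "L1 \<Rightarrow> L1" where
  "sgn_L1 x = inverse (norm x) *\<^sub>R x"

definition uniformity_L1 :: "(L1 \<times> L1) filter" where
  "uniformity_L1 = (INF e\<in>{0<..}. principal {(x, y). dist x y < e})"

definition open_L1 :: "L1 set \<Rightarrow> bool" where
  "open_L1 U \<longleftrightarrow> (\<forall>x\<in>U. eventually (\<lambda>(x', y). x' = x \<longrightarrow> y \<in> U) uniformity)"

instance
proof
  fix x y z :: L1 and a b :: real
  show "x + y + z = x + (y + z)"
    by transfer (auto simp: L1_rel_def algebra_simps)
  show "x + y = y + x"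
    by transfer (auto simp: L1_rel_def algebra_simps)
  show "0 + x = x"
    by transfer (auto simp: L1_rel_def)
  show "- x + x = 0"
    by transfer (auto simp: L1_rel_def)
  show "x - y = x + - y"
    by transfer (auto simp: L1_rel_def)
  show "a *\<^sub>R (x + y) = a *\<^sub>R x + a *\<^sub>R y"
    by transfer (auto simp: L1_rel_def algebra_simps)
  show "(a + b) *\<^sub>R x = a *\<^sub>R x + b *\<^sub>R x"
    by transfer (auto simp: L1_rel_def algebra_simps)
  show "a *\<^sub>R b *\<^sub>R x = (a * b) *\<^sub>R x"
    by transfer (auto simp: L1_rel_def algebra_simps)
  show "1 *\<^sub>R x = x"
    by transfer (auto simp: L1_rel_def)
  show "dist x y = norm (x - y)"
    by (rule dist_L1_def)
  show "sgn x = inverse (norm x) *\<^sub>R x"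
    by (rule sgn_L1_def)
  show "uniformity = (INF e\<in>{0<..}. principal {(x, y :: L1). dist x y < e})"
    by (rule uniformity_L1_def)
  show "open U \<longleftrightarrow> (\<forall>x\<in>U. eventually (\<lambda>(x', y). x' = x \<longrightarrow> y \<in> U) uniformity)" for U :: "L1 set"
    by (rule open_L1_def)
  show "norm x = 0 \<longleftrightarrow> x = 0"
    by transfer (auto simp: L1_rel_def integral_nonneg_eq_0_iff_AE)
  show "norm (x + y) \<le> norm x + norm y"
  proof transfer
    fix f g assume "L1_rel f f" "L1_rel g g"
    then have f: "integrable unit_interval_measure f" and g: "integrable unit_interval_measure g"
      by (auto simp: L1_rel_def)
    have "(\<integral>t. \<bar>f t + g t\<bar> \<partial>unit_interval_measure)
        \<le> (\<integral>t. \<bar>f t\<bar> + \<bar>g t\<bar> \<partial>unit_interval_measure)"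
      by (rule integral_mono) (use f g in auto)
    also have "\<dots> = (\<integral>t. \<bar>f t\<bar> \<partial>unit_interval_measure) + (\<integral>t. \<bar>g t\<bar> \<partial>unit_interval_measure)"
      by (rule Bochner_Integration.integral_add) (use f g in auto)
    finally show "(\<integral>t. \<bar>f t + g t\<bar> \<partial>unit_interval_measure)
        \<le> (\<integral>t. \<bar>f t\<bar> \<partial>unit_interval_measure) + (\<integral>t. \<bar>g t\<bar> \<partial>unit_interval_measure)" .
  qed
  show "norm (a *\<^sub>R x) = \<bar>a\<bar> * norm x"
    by transfer (simp add: abs_mult)
qed

end

lift_definition L1_integral :: "L1 \<Rightarrow> real" is "\<lambda>f. \<integral>t. f t \<partial>unit_interval_measure"
  by (rule integral_cong_AE) (auto simp: L1_rel_def)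

definition M1 :: "L1 set" where
  "M1 = {x. L1_integral x = 0}"

lemma subspace_M1: "subspace M1"
proof -
  have "L1_integral 0 = 0"
    by transfer simp
  moreover have "L1_integral (x + y) = L1_integral x + L1_integral y" for x y
    by transfer (auto simp: L1_rel_def)
  moreover have "L1_integral (c *\<^sub>R x) = c * L1_integral x" for c x
    by transfer (auto simp: L1_rel_def)
  ultimately show ?thesis
    by (auto simp: M1_def subspace_def)
qed

text \<open>
  The following notions concern a linear subspace \<open>E\<close> of a normed space, regarded as a normed
  space in its own right under the inherited norm. An automorphism of \<open>E\<close> is represented by any
  map on the ambient space that restricts to it; it need not be linear, nor isometric, nor injective,
  outside \<open>E\<close>. Closures are taken relative to \<open>E\<close>.
\<close>

definition unit_sphere :: "'a::real_normed_vector set \<Rightarrow> 'a set" where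
  "unit_sphere E = {x \<in> E. norm x = 1}"

definition isometric_automorphisms :: "'a::real_normed_vector set \<Rightarrow> ('a \<Rightarrow> 'a) set" where
  "isometric_automorphisms E = {T.
     T ` E = E \<and>
     (\<forall>x\<in>E. \<forall>y\<in>E. T (x + y) = T x + T y) \<and>
     (\<forall>c. \<forall>x\<in>E. T (c *\<^sub>R x) = c *\<^sub>R T x) \<and>
     (\<forall>x\<in>E. norm (T x) = norm x)}"

definition isometric_orbit :: "'a::real_normed_vector set \<Rightarrow> 'a \<Rightarrow> 'a set" where
  "isometric_orbit E x = {T x | T. T \<in> isometric_automorphisms E}"

definition almost_transitive :: "'a::real_normed_vector set \<Rightarrow> bool" where
  "almost_transitive E \<longleftrightarrow>
     (\<forall>x\<in>unit_sphere E. (top_of_set E) closure_of (isometric_orbit E x) = unit_sphere E)"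

end

theory Submission
  imports Defs "HOL-Probability.Weak_Convergence"
begin

text \<open>
  Every point of the unit sphere of \<^term>\<open>M1\<close> can be perturbed slightly so that an isometric
  automorphism carries it to one fixed function: the function \<open>h\<close> that is \<open>1\<close> on the first half of the
  unit interval and \<open>-1\<close> on the second half. This suffices. If \<open>S x' = h\<close> and \<open>T y' = h\<close> with \<open>x'\<close> near
  \<open>x\<close> and \<open>y'\<close> near \<open>y\<close>, then the automorphism \<open>T\<close>-inverse after \<open>S\<close> maps \<open>x'\<close> to \<open>y'\<close>, hence \<open>x\<close>
  close to \<open>y\<close> (lemma \<open>almost_transitiveI\<close>).

  The perturbation makes \<open>x\<close> nonzero almost everywhere. The function \<open>x - a h\<close> vanishes where
  \<open>x h = a\<close>, because \<open>h\<close> takes only the values \<open>1\<close> and \<open>-1\<close>; the distribution of \<open>x h\<close> has only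
  countably many atoms, so arbitrarily small \<open>a\<close> are available (lemma \<open>nonvanishing_dense\<close>).

  For a nowhere vanishing \<open>x\<close> of norm one and mean zero, the probability measure \<open>|x| dt\<close> can be
  transported to Lebesgue measure in such a way that the set where \<open>x\<close> is positive, which has mass
  \<open>1/2\<close>, fills the first half of the interval. The device is to translate the set where \<open>x\<close> is
  negative by \<open>1\<close>, so that it lies to the right of the set where \<open>x\<close> is positive, and then to use the
  distribution function of the resulting atomless measure on the line and its quantile function
  (lemma \<open>rearrangement\<close>). If \<open>q\<close> maps Lebesgue measure to \<open>|x| dt\<close>, then
  \<open>f \<mapsto> (f / |x|) \<circ> q\<close> preserves norms and integrals. It is onto, since \<open>q\<close> has a measurable
  left inverse, and it maps \<open>x\<close> to \<open>sgn x \<circ> q\<close>, which is \<open>h\<close> (lemma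
  \<open>nonvanishing_to_half_sign\<close>). All of this is done with Borel representatives of the classes in
  \<^typ>\<open>L1\<close>, so that compositions are measurable.
\<close>

section \<open>Isometric automorphisms of a subspace\<close>

lemma isometric_automorphism_diff:
  assumes E: "subspace E" and T: "T \<in> isometric_automorphisms E" and "x \<in> E" "y \<in> E"
  shows "T (x - y) = T x - T y"
proof -
  have "T (x + (-1) *\<^sub>R y) = T x + T ((-1) *\<^sub>R y)" "T ((-1) *\<^sub>R y) = (-1) *\<^sub>R T y"
    using assms subspace_scale[OF E, of y "-1"]
    unfolding isometric_automorphisms_def by blast+
  then show ?thesis by simp
qed

lemma isometric_automorphism_dist:
  assumes E: "subspace E" and T: "T \<in> isometric_automorphisms E" and "x \<in> E" "y \<in> E"
  shows "dist (T x) (T y) = dist x y"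
  using assms subspace_diff[OF E, of x y] isometric_automorphism_diff[OF assms]
  by (metis (mono_tags, lifting) dist_norm isometric_automorphisms_def mem_Collect_eq)

lemma isometric_automorphism_inj:
  assumes "subspace E" "T \<in> isometric_automorphisms E"
  shows "inj_on T E"
  using isometric_automorphism_dist[OF assms] by (metis dist_eq_0_iff inj_onI)

lemma inv_into_isometric_automorphism:
  assumes E: "subspace E" and T: "T \<in> isometric_automorphisms E"
  shows "inv_into E T \<in> isometric_automorphisms E"
proof -
  have im: "T ` E = E" and add: "\<And>x y. x \<in> E \<Longrightarrow> y \<in> E \<Longrightarrow> T (x + y) = T x + T y"
    and scale: "\<And>c x. x \<in> E \<Longrightarrow> T (c *\<^sub>R x) = c *\<^sub>R T x"
    and norm: "\<And>x. x \<in> E \<Longrightarrow> norm (T x) = norm x"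
    using T by (auto simp: isometric_automorphisms_def)
  note inj = isometric_automorphism_inj[OF E T]
  let ?S = "inv_into E T"
  have S: "?S x \<in> E" "T (?S x) = x" if "x \<in> E" for x
    using that im by (auto intro: inv_into_into f_inv_into_f)
  have ST: "?S (T x) = x" if "x \<in> E" for x
    using inj that by simp
  have "?S ` E = E"
    using inv_into_image_cancel[OF inj order_refl] im by simp
  moreover have "?S (x + y) = ?S x + ?S y" if "x \<in> E" "y \<in> E" for x y
    using ST[of "?S x + ?S y"] add[of "?S x" "?S y"] that S subspace_add[OF E] by simp
  moreover have "?S (c *\<^sub>R x) = c *\<^sub>R ?S x" if "x \<in> E" for x c
    using ST[of "c *\<^sub>R ?S x"] scale[of "?S x" c] that S subspace_scale[OF E] by simp
  moreover have "norm (?S x) = norm x" if "x \<in> E" for x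
    using norm[of "?S x"] that S by simp
  ultimately show ?thesis
    by (simp add: isometric_automorphisms_def)
qed

lemma comp_isometric_automorphism:
  assumes "S \<in> isometric_automorphisms E" "T \<in> isometric_automorphisms E"
  shows "S \<circ> T \<in> isometric_automorphisms E"
proof -
  have "S ` T ` E = E" "\<And>x. x \<in> E \<Longrightarrow> T x \<in> E"
    using assms by (auto simp: isometric_automorphisms_def)
  then show ?thesis
    using assms by (simp add: isometric_automorphisms_def image_comp)
qed

text \<open>
  A point \<open>e\<close> that can be reached from a dense set of starting points makes the group act almost
  transitively, because every automorphism can be inverted and none increases approximation errors.
\<close>

lemma almost_transitiveI:
  fixes E :: "'a::real_normed_vector set"
  assumes E: "subspace E"
    and dense: "\<And>x \<epsilon>. x \<in> unit_sphere E \<Longrightarrow> 0 < \<epsilon> \<Longrightarrow>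
      \<exists>x'\<in>E. \<exists>T\<in>isometric_automorphisms E. dist x x' < \<epsilon> \<and> T x' = e"
  shows "almost_transitive E"
  unfolding almost_transitive_def
proof
  fix x assume x: "x \<in> unit_sphere E"
  have orbit: "isometric_orbit E x \<subseteq> unit_sphere E"
    using x by (auto simp: isometric_orbit_def isometric_automorphisms_def unit_sphere_def)
  then have orbit_E: "isometric_orbit E x \<subseteq> E"
    by (auto simp: unit_sphere_def)
  have cl: "(top_of_set E) closure_of (isometric_orbit E x) = E \<inter> closure (isometric_orbit E x)"
    using orbit_E by (simp add: closure_of_subtopology Int_absorb1)
  have "closure (isometric_orbit E x) \<subseteq> {z. norm z = 1}"
    using orbit by (intro closure_minimal closed_Collect_eq continuous_intros)
      (auto simp: unit_sphere_def)
  moreover have "y \<in> closure (isometric_orbit E x)" if y: "y \<in> unit_sphere E" for y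
    unfolding closure_approachable
  proof (intro allI impI)
    fix \<epsilon> :: real assume "0 < \<epsilon>"
    then obtain x' S where x': "x' \<in> E" "dist x x' < \<epsilon> / 2"
      and S: "S \<in> isometric_automorphisms E" "S x' = e"
      using dense[OF x, of "\<epsilon> / 2"] by auto
    obtain y' T where y': "y' \<in> E" "dist y y' < \<epsilon> / 2"
      and T: "T \<in> isometric_automorphisms E" "T y' = e"
      using dense[OF y, of "\<epsilon> / 2"] \<open>0 < \<epsilon>\<close> by auto
    have T': "inv_into E T \<in> isometric_automorphisms E"
      by (rule inv_into_isometric_automorphism[OF E T(1)])
    let ?R = "inv_into E T \<circ> S"
    have R: "?R \<in> isometric_automorphisms E"
      by (rule comp_isometric_automorphism[OF T' S(1)])
    have "?R x' = y'"
      using isometric_automorphism_inj[OF E T(1)] y'(1) S(2) T(2) by (metis comp_apply inv_into_f_f)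
    then have "dist (?R x) y' = dist x x'"
      using isometric_automorphism_dist[OF E R, of x x'] x x'(1) by (simp add: unit_sphere_def)
    then have "dist (?R x) y < \<epsilon>"
      using x' y' dist_triangle2[of "?R x" y y'] by linarith
    then show "\<exists>z\<in>isometric_orbit E x. dist z y < \<epsilon>"
      using R by (auto simp: isometric_orbit_def)
  qed
  ultimately show "(top_of_set E) closure_of (isometric_orbit E x) = unit_sphere E"
    unfolding cl by (auto simp: unit_sphere_def)
qed

section \<open>Borel representatives\<close>

text \<open>
  The uniform distribution lives on the Borel sets of the whole line: measurability of compositions
  is then plain Borel measurability, and the theory of distribution functions on the line applies.
  The open interval matches the domain on which quantile functions are defined.
\<close>

definition unif :: "real measure" where
  "unif = density lborel (\<lambda>t. ennreal (indicator {0<..<1} t))"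

lemma sets_unif [simp, measurable_cong]: "sets unif = sets borel"
  by (simp add: unif_def)

lemma space_unif [simp]: "space unif = UNIV"
  by (simp add: unif_def)

lemma AE_unif_iff: "(AE t in unif. P t) \<longleftrightarrow> (AE t in lborel. 0 < t \<and> t < 1 \<longrightarrow> P t)"
  unfolding unif_def by (subst AE_density) (auto simp: indicator_def)

lemma emeasure_unif: "A \<in> sets borel \<Longrightarrow> emeasure unif A = emeasure lborel ({0<..<1} \<inter> A)"
  using emeasure_restricted[of "{0<..<1}" lborel A]
  by (simp add: unif_def ennreal_indicator)

lemma prob_space_unif: "prob_space unif"
  by (rule prob_spaceI) (simp add: emeasure_unif)

lemma AE_unit_interval_iff:
  "(AE t in unit_interval_measure. P t) \<longleftrightarrow> (AE t in unif. P t)"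
proof -
  have "(AE t in unit_interval_measure. P t) \<longleftrightarrow> (AE t in lborel. t \<in> {0..1} \<longrightarrow> P t)"
    by (simp add: AE_restrict_space_iff AE_completion_iff)
  also have "\<dots> \<longleftrightarrow> (AE t in lborel. 0 < t \<and> t < 1 \<longrightarrow> P t)"
  proof
    assume "AE t in lborel. t \<in> {0..1} \<longrightarrow> P t"
    then show "AE t in lborel. 0 < t \<and> t < 1 \<longrightarrow> P t"
      by eventually_elim auto
  next
    assume "AE t in lborel. 0 < t \<and> t < 1 \<longrightarrow> P t"
    then show "AE t in lborel. t \<in> {0..1} \<longrightarrow> P t"
      using AE_lborel_singleton[of 0] AE_lborel_singleton[of 1]
      by eventually_elim auto
  qed
  finally show ?thesis by (simp add: AE_unif_iff)
qed

lemma
  fixes f :: "real \<Rightarrow> real"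
  assumes [measurable]: "f \<in> borel_measurable borel"
  shows integrable_unit_interval_iff: "integrable unit_interval_measure f \<longleftrightarrow> integrable unif f"
    and integral_unit_interval_eq: "integral\<^sup>L unit_interval_measure f = integral\<^sup>L unif f"
proof -
  have ae: "AE t in lborel. indicator {0..1} t *\<^sub>R f t = indicator {0<..<1} t *\<^sub>R f t"
    using AE_lborel_singleton[of 0] AE_lborel_singleton[of 1]
    by eventually_elim (auto simp: indicator_def)
  have "integrable unit_interval_measure f \<longleftrightarrow> integrable lborel (\<lambda>t. indicator {0..1} t *\<^sub>R f t)"
    by (simp add: integrable_restrict_space integrable_completion)
  also have "\<dots> \<longleftrightarrow> integrable lborel (\<lambda>t. indicator {0<..<1} t *\<^sub>R f t)"
    using ae by (intro integrable_cong_AE) auto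
  finally show "integrable unit_interval_measure f \<longleftrightarrow> integrable unif f"
    by (simp add: unif_def integrable_density)
  have "integral\<^sup>L unit_interval_measure f = integral\<^sup>L lborel (\<lambda>t. indicator {0..1} t *\<^sub>R f t)"
    by (simp add: integral_restrict_space integral_completion)
  also have "\<dots> = integral\<^sup>L lborel (\<lambda>t. indicator {0<..<1} t *\<^sub>R f t)"
    using ae by (intro integral_cong_AE) auto
  finally show "integral\<^sup>L unit_interval_measure f = integral\<^sup>L unif f"
    by (simp add: unif_def integral_density)
qed

definition represents :: "(real \<Rightarrow> real) \<Rightarrow> L1 \<Rightarrow> bool" where
  "represents f X \<longleftrightarrow> f \<in> borel_measurable borel \<and> integrable unif f \<and> X = abs_L1 f"

lemma L1_rel_iff:
  assumes "f \<in> borel_measurable borel" "g \<in> borel_measurable borel"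
  shows "L1_rel f g \<longleftrightarrow> integrable unif f \<and> integrable unif g \<and> (AE t in unif. f t = g t)"
  using assms by (simp add: L1_rel_def integrable_unit_interval_iff AE_unit_interval_iff)

lemma representsD:
  assumes "represents f X"
  shows "f \<in> borel_measurable borel" "integrable unif f" "L1_rel f f" "X = abs_L1 f"
  using assms by (auto simp: represents_def L1_rel_iff)

text \<open>
  A Lebesgue measurable function agrees almost everywhere with a Borel function. Only for Borel
  functions is composition with an arbitrary Borel map measurable, so the operators below are
  defined on such representatives.
\<close>

lemma represents_exists: "\<exists>f. represents f X"
proof -
  obtain g where g: "L1_rel g g" "X = abs_L1 g"
    by (metis Quotient_L1 Quotient_abs_rep Quotient_rep_reflp)
  then have "integrable unit_interval_measure g"
    by (simp add: L1_rel_def)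
  then have "(\<lambda>t. indicator {0..1} t *\<^sub>R g t) \<in> borel_measurable lebesgue"
    by (simp add: integrable_restrict_space)
  then obtain f where f [measurable]: "f \<in> borel_measurable lborel"
    and ae: "AE t in lborel. indicator {0..1} t *\<^sub>R g t = f t"
    using completion_ex_borel_measurable_real by blast
  have "AE t in unif. g t = f t"
    unfolding AE_unif_iff using ae by eventually_elim auto
  then have ae': "AE t in unit_interval_measure. g t = f t"
    by (simp add: AE_unit_interval_iff)
  have "integrable unit_interval_measure f"
    using \<open>integrable unit_interval_measure g\<close> ae' f
    by (subst integrable_cong_AE[of _ _ g]) (auto intro!: measurable_restrict_space1 measurable_completion)
  then have "L1_rel g f"
    using g(1) ae' by (simp add: L1_rel_def)
  then have "abs_L1 g = abs_L1 f"
    using Quotient_rel_abs[OF Quotient_L1] by blast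
  then show ?thesis
    using f \<open>integrable unit_interval_measure f\<close> g(2)
    by (intro exI[of _ f]) (simp add: represents_def integrable_unit_interval_iff)
qed

lemma represents_eq_iff:
  assumes "represents f X" "represents g Y"
  shows "X = Y \<longleftrightarrow> (AE t in unif. f t = g t)"
proof -
  note f = representsD[OF assms(1)] and g = representsD[OF assms(2)]
  have "X = Y \<longleftrightarrow> L1_rel f g"
    unfolding f(4) g(4) using Quotient_rel[OF Quotient_L1, of f g] f(3) g(3) by blast
  then show ?thesis
    using f(1,2) g(1,2) by (simp add: L1_rel_iff)
qed

lemma represents_add: "represents f X \<Longrightarrow> represents g Y \<Longrightarrow> represents (\<lambda>t. f t + g t) (X + Y)"
  unfolding represents_def
  by (auto simp: L1_rel_iff plus_L1.abs_eq)

lemma represents_diff: "represents f X \<Longrightarrow> represents g Y \<Longrightarrow> represents (\<lambda>t. f t - g t) (X - Y)"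
  unfolding represents_def
  by (auto simp: L1_rel_iff minus_L1.abs_eq)

lemma represents_scaleR: "represents f X \<Longrightarrow> represents (\<lambda>t. c * f t) (c *\<^sub>R X)"
  unfolding represents_def
  by (auto simp: L1_rel_iff scaleR_L1.abs_eq)

lemma represents_norm: "represents f X \<Longrightarrow> norm X = (\<integral>t. \<bar>f t\<bar> \<partial>unif)"
  unfolding represents_def
  by (auto simp: L1_rel_iff norm_L1.abs_eq integral_unit_interval_eq)

lemma represents_integral: "represents f X \<Longrightarrow> L1_integral X = (\<integral>t. f t \<partial>unif)"
  unfolding represents_def
  by (auto simp: L1_rel_iff L1_integral.abs_eq integral_unit_interval_eq)


section \<open>Rearranging a nowhere vanishing function\<close>

definition half_sign :: "real \<Rightarrow> real" where
  "half_sign s = (if s \<le> 1/2 then 1 else -1)"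

lemma half_sign_measurable [measurable]: "half_sign \<in> borel_measurable borel"
  unfolding half_sign_def by measurable

text \<open>
  The quantile function always satisfies \<open>s \<le> C (I s)\<close> and has \<open>C r < s\<close> for \<open>r < I s\<close>; without atoms the
  distribution function is continuous from the left, which turns this into an equality.
\<close>

lemma (in cdf_distribution) cdf_quantile:
  assumes atomless: "\<And>r. measure M {r} = 0" and s: "0 < s" "s < 1"
  shows "C (I s) = s"
proof (rule antisym)
  show "s \<le> C (I s)"
    using pseudoinverse[OF s, of "I s"] by simp
  have "(C \<longlongrightarrow> C (I s)) (at_left (I s))"
    using isCont_cdf[of "I s"] atomless
    by (auto simp: isCont_def intro: filterlim_at_split[THEN iffD1, THEN conjunct1])
  moreover have "eventually (\<lambda>r. C r \<le> s) (at_left (I s))"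
  proof (rule eventually_mono)
    show "eventually (\<lambda>r. r \<in> {I s - 1<..<I s}) (at_left (I s))"
      by (rule eventually_at_left_real) simp
    show "C r \<le> s" if "r \<in> {I s - 1<..<I s}" for r
      using that pseudoinverse[OF s, of r] by auto
  qed
  ultimately show "C (I s) \<le> s"
    by (rule tendsto_upperbound) simp
qed

text \<open>
  The transport from Lebesgue measure to \<open>|x| dt\<close> that sorts by sign. With \<open>\<theta>\<close> shifting the negative
  part of \<open>x\<close> by \<open>1\<close> and \<open>\<kappa>\<close> undoing the shift, \<open>q\<close> is \<open>\<kappa>\<close> after the quantile function and \<open>\<psi>\<close> is the
  distribution function after \<open>\<theta>\<close>, both taken for the image \<open>\<mu>\<close> of \<open>|x| dt\<close> under \<open>\<theta>\<close>. The last
  conclusion says that \<open>x (q s)\<close> has the sign \<open>half_sign s\<close>.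
\<close>

lemma rearrangement:
  fixes x :: "real \<Rightarrow> real"
  assumes x [measurable]: "x \<in> borel_measurable borel" and int: "integrable unif x"
    and nz: "AE t in unif. x t \<noteq> 0"
    and mean: "(\<integral>t. x t \<partial>unif) = 0" and norm: "(\<integral>t. \<bar>x t\<bar> \<partial>unif) = 1"
  obtains q \<psi> where "q \<in> borel_measurable borel" "\<psi> \<in> borel_measurable borel"
    "distr unif borel q = density unif (\<lambda>t. ennreal \<bar>x t\<bar>)"
    "AE s in unif. \<psi> (q s) = s"
    "AE s in unif. x (q s) = \<bar>x (q s)\<bar> * half_sign s"
proof -
  define \<nu> where "\<nu> = density unif (\<lambda>t. ennreal \<bar>x t\<bar>)"
  have sets_\<nu> [simp, measurable_cong]: "sets \<nu> = sets borel"
    by (simp add: \<nu>_def)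
  have space_\<nu> [simp]: "space \<nu> = UNIV"
    by (simp add: \<nu>_def)
  have "emeasure \<nu> UNIV = (\<integral>\<^sup>+t. ennreal \<bar>x t\<bar> \<partial>unif)"
    by (simp add: \<nu>_def emeasure_density)
  also have "\<dots> = 1"
    using int norm by (subst nn_integral_eq_integral) auto
  finally interpret \<nu>: prob_space \<nu>
    by (intro prob_spaceI) simp
  have AE_\<nu>: "(AE t in \<nu>. P t) \<longleftrightarrow> (AE t in unif. x t \<noteq> 0 \<longrightarrow> P t)" for P
    unfolding \<nu>_def by (subst AE_density) auto
  define \<theta> where "\<theta> t = (if 0 < x t then t else t + 1)" for t
  define \<kappa> where "\<kappa> r = (if r \<le> 1 then r else r - 1 :: real)" for r
  have [measurable]: "\<theta> \<in> borel_measurable borel" "\<kappa> \<in> borel_measurable borel"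
    unfolding \<theta>_def \<kappa>_def by measurable
  have AE_01: "AE t in \<nu>. 0 < t \<and> t < 1 \<and> x t \<noteq> 0"
    unfolding AE_\<nu> AE_unif_iff by simp
  have \<kappa>\<theta>: "\<kappa> (\<theta> t) = t" if "0 < t" "t < 1" for t
    using that by (simp add: \<kappa>_def \<theta>_def)
  define \<mu> where "\<mu> = distr \<nu> borel \<theta>"
  have [simp, measurable_cong]: "sets \<mu> = sets borel"
    by (simp add: \<mu>_def)
  have AE_\<mu>: "(AE r in \<mu>. P r) \<longleftrightarrow> (AE t in \<nu>. P (\<theta> t))" if "{r. P r} \<in> sets borel" for P
    unfolding \<mu>_def using that by (intro AE_distr_iff) auto
  interpret \<mu>: cdf_distribution \<mu>
    unfolding cdf_distribution_def \<mu>_def by (rule \<nu>.real_distribution_distr) simp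
  \<comment> \<open>The preimage of a point under \<open>\<theta>\<close> has at most two elements.\<close>
  have atomless: "measure \<mu> {r} = 0" for r
  proof -
    have "AE t in lborel. t \<noteq> r \<and> t \<noteq> r - 1"
      using AE_lborel_singleton[of r] AE_lborel_singleton[of "r - 1"] by eventually_elim simp
    then have "AE t in \<nu>. \<theta> t \<noteq> r"
      unfolding AE_\<nu> AE_unif_iff by eventually_elim (auto simp: \<theta>_def)
    then have "AE u in \<mu>. u \<noteq> r"
      by (subst AE_\<mu>) auto
    then show ?thesis
      by (subst (asm) AE_iff_measurable[of "{r}"]) (auto simp: measure_def)
  qed
  define Q where "Q = \<mu>.I"
  have Q: "Q \<in> borel_measurable (restrict_space borel {0<..<1})"
    unfolding Q_def by (rule \<mu>.measurable_CI)
  have C_Q: "\<mu>.C (Q s) = s" if "0 < s" "s < 1" for s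
    unfolding Q_def by (rule \<mu>.cdf_quantile[OF atomless that])
  have Q_le: "s \<le> \<mu>.C r \<longleftrightarrow> Q s \<le> r" if "0 < s" "s < 1" for s r
    unfolding Q_def by (rule \<mu>.pseudoinverse[OF that])
  \<comment> \<open>The quantile function is meaningful, and known to be measurable, only on the open unit interval.\<close>
  define J where "J s = (if s \<in> {0<..<1} then Q s else 0)" for s
  have J [measurable]: "J \<in> borel_measurable borel"
    unfolding J_def by (rule iffD1[OF measurable_restrict_space_iff Q]) simp_all
  have distr_J: "distr unif borel J = \<mu>"
  proof -
    have "distr unif borel J = distr (restrict_space lborel {0<..<1}) borel Q"
    proof (rule measure_eqI)
      fix A :: "real set" assume "A \<in> sets (distr unif borel J)"
      then have A: "A \<in> sets borel" by simp
      have "emeasure (distr unif borel J) A = emeasure lborel ({0<..<1} \<inter> J -` A)"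
        using A measurable_sets[OF J A] by (simp add: emeasure_distr emeasure_unif)
      also have "{0<..<1} \<inter> J -` A = Q -` A \<inter> {0<..<1}"
        by (auto simp: J_def)
      also have "emeasure lborel \<dots> = emeasure (restrict_space lborel {0<..<1}) (Q -` A \<inter> {0<..<1})"
        by (rule emeasure_restrict_space[symmetric]) auto
      also have "\<dots> = emeasure (distr (restrict_space lborel {0<..<1}) borel Q) A"
        using Q A by (subst emeasure_distr) (simp_all add: space_restrict_space cong: measurable_cong_sets)
      finally show "emeasure (distr unif borel J) A
          = emeasure (distr (restrict_space lborel {0<..<1}) borel Q) A" .
    qed simp
    also have "\<dots> = \<mu>"
      unfolding Q_def by (rule \<mu>.distr_I_eq_M)
    finally show ?thesis .
  qed
  have AE_J: "AE s in unif. P (J s)" if "AE t in \<nu>. P (\<theta> t)" "{r. P r} \<in> sets borel" for P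
  proof -
    have "AE r in distr unif borel J. P r"
      unfolding distr_J by (rule iffD2[OF AE_\<mu>[OF that(2)] that(1)])
    then show ?thesis
      by (rule AE_distrD[rotated]) simp
  qed
  have AE_01_unif: "AE s in unif. 0 < s \<and> s < 1"
    unfolding AE_unif_iff by simp
  show thesis
  proof (rule that[of "\<kappa> \<circ> J" "\<mu>.C \<circ> \<theta>"])
    show "\<kappa> \<circ> J \<in> borel_measurable borel" "\<mu>.C \<circ> \<theta> \<in> borel_measurable borel"
      using \<mu>.measurable_C by (auto intro!: measurable_comp)
    have "distr unif borel (\<kappa> \<circ> J) = distr \<mu> borel \<kappa>"
      unfolding distr_J[symmetric] by (rule distr_distr[symmetric]) simp_all
    also have "\<dots> = distr \<nu> borel (\<kappa> \<circ> \<theta>)"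
      unfolding \<mu>_def by (rule distr_distr) simp_all
    also have "\<dots> = distr \<nu> borel (\<lambda>t. t)"
    proof (rule distr_cong_AE)
      show "AE t in \<nu>. (\<kappa> \<circ> \<theta>) t = t"
        using AE_01 by eventually_elim (simp add: \<kappa>\<theta>)
    qed simp_all
    also have "\<dots> = \<nu>"
      by (rule distr_id2) simp
    finally show "distr unif borel (\<kappa> \<circ> J) = density unif (\<lambda>t. ennreal \<bar>x t\<bar>)"
      by (simp add: \<nu>_def)
    have "AE s in unif. \<theta> (\<kappa> (J s)) = J s"
    proof (rule AE_J)
      show "AE t in \<nu>. \<theta> (\<kappa> (\<theta> t)) = \<theta> t"
        using AE_01 by eventually_elim (simp add: \<kappa>\<theta>)
    qed measurable
    then show "AE s in unif. (\<mu>.C \<circ> \<theta>) ((\<kappa> \<circ> J) s) = s"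
      using AE_01_unif by eventually_elim (simp add: J_def C_Q)
    \<comment> \<open>The point \<open>1\<close> separates the two parts of \<open>\<mu>\<close>, so its distribution function there is the mass of
      the positive part of \<open>x\<close>, which the vanishing mean makes one half of the norm.\<close>
    have C1: "\<mu>.C 1 = 1/2"
    proof -
      have "\<mu>.C 1 = measure \<nu> {t. \<theta> t \<le> 1}"
        by (simp add: cdf_def \<mu>_def measure_distr vimage_def)
      also have "\<dots> = (\<integral>t. indicator {t. \<theta> t \<le> 1} t \<partial>\<nu>)"
        by simp
      also have "\<dots> = (\<integral>t. \<bar>x t\<bar> * indicator {t. \<theta> t \<le> 1} t \<partial>unif)"
        unfolding \<nu>_def by (subst integral_density) auto
      also have "\<dots> = (\<integral>t. (\<bar>x t\<bar> + x t) / 2 \<partial>unif)"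
      proof (rule integral_cong_AE)
        show "AE t in unif. \<bar>x t\<bar> * indicator {t. \<theta> t \<le> 1} t = (\<bar>x t\<bar> + x t) / 2"
          using AE_01_unif by eventually_elim (simp add: \<theta>_def indicator_def)
      qed measurable
      also have "\<dots> = 1/2"
        using int mean norm by simp
      finally show ?thesis .
    qed
    have "AE s in unif. x (\<kappa> (J s)) = \<bar>x (\<kappa> (J s))\<bar> * (if J s \<le> 1 then 1 else -1)"
    proof (rule AE_J)
      show "AE t in \<nu>. x (\<kappa> (\<theta> t)) = \<bar>x (\<kappa> (\<theta> t))\<bar> * (if \<theta> t \<le> 1 then 1 else -1)"
        using AE_01 by eventually_elim (simp add: \<kappa>_def \<theta>_def)
    qed measurable
    then show "AE s in unif. x ((\<kappa> \<circ> J) s) = \<bar>x ((\<kappa> \<circ> J) s)\<bar> * half_sign s"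
      using AE_01_unif
    proof eventually_elim
      case (elim s)
      have "J s \<le> 1 \<longleftrightarrow> s \<le> 1/2"
        using elim(2) Q_le[of s 1] C1 by (simp add: J_def)
      then show ?case
        using elim(1) by (simp add: half_sign_def)
    qed
  qed
qed


section \<open>The induced isometry\<close>

text \<open>
  The automorphism is \<open>f \<mapsto> (f / |x|) \<circ> q\<close> with the transport \<open>q\<close> of the preceding lemma. Dividing by
  \<open>|x|\<close> identifies the integrable functions with those integrable for \<open>|x| dt\<close>, and \<open>q\<close> carries the
  latter measure back to Lebesgue measure. Since \<open>x\<close> vanishes almost nowhere, both steps respect
  equality almost everywhere and the first loses nothing.
\<close>

lemma nonvanishing_to_half_sign:
  assumes x: "represents x X" and nz: "AE t in unif. x t \<noteq> 0"
    and norm: "norm X = 1" and mean: "X \<in> M1"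
  shows "\<exists>T\<in>isometric_automorphisms M1. T X = abs_L1 half_sign"
proof -
  have xm [measurable]: "x \<in> borel_measurable borel" and int_x: "integrable unif x"
    using representsD[OF x] by auto
  have mean_x: "(\<integral>t. x t \<partial>unif) = 0"
    using mean represents_integral[OF x] by (simp add: M1_def)
  have norm_x: "(\<integral>t. \<bar>x t\<bar> \<partial>unif) = 1"
    using norm represents_norm[OF x] by simp
  obtain q \<psi> where q [measurable]: "q \<in> borel_measurable borel"
    and \<psi> [measurable]: "\<psi> \<in> borel_measurable borel"
    and distr_q: "distr unif borel q = density unif (\<lambda>t. ennreal \<bar>x t\<bar>)"
    and \<psi>q: "AE s in unif. \<psi> (q s) = s"
    and xq: "AE s in unif. x (q s) = \<bar>x (q s)\<bar> * half_sign s"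
    by (rule rearrangement[OF xm int_x nz mean_x norm_x])
  have AE_q: "AE s in unif. P (q s)" if "AE t in unif. P t" "{t. P t} \<in> sets borel" for P
  proof -
    have "AE t in distr unif borel q. P t"
      unfolding distr_q using that(1) by (subst AE_density) auto
    then show ?thesis
      by (rule AE_distrD[rotated]) simp
  qed
  have nzq: "AE s in unif. x (q s) \<noteq> 0"
    using nz by (rule AE_q) measurable
  have int_q: "integrable unif (\<lambda>s. h (q s)) \<longleftrightarrow> integrable unif (\<lambda>t. \<bar>x t\<bar> * h t)"
    and integral_q: "(\<integral>s. h (q s) \<partial>unif) = (\<integral>t. \<bar>x t\<bar> * h t \<partial>unif)"
    if [measurable]: "h \<in> borel_measurable borel" for h :: "real \<Rightarrow> real"
  proof -
    have "integrable unif (\<lambda>s. h (q s)) \<longleftrightarrow> integrable (distr unif borel q) h"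
      by (subst integrable_distr_eq) auto
    then show "integrable unif (\<lambda>s. h (q s)) \<longleftrightarrow> integrable unif (\<lambda>t. \<bar>x t\<bar> * h t)"
      unfolding distr_q by (subst (asm) integrable_density) auto
    have "(\<integral>s. h (q s) \<partial>unif) = (\<integral>t. h t \<partial>distr unif borel q)"
      by (subst integral_distr) auto
    then show "(\<integral>s. h (q s) \<partial>unif) = (\<integral>t. \<bar>x t\<bar> * h t \<partial>unif)"
      unfolding distr_q by (subst (asm) integral_density) auto
  qed
  define R where "R f s = f (q s) / \<bar>x (q s)\<bar>" for f :: "real \<Rightarrow> real" and s
  have R_measurable [measurable]: "R f \<in> borel_measurable borel" if [measurable]: "f \<in> borel_measurable borel" for f
    unfolding R_def by measurable
  have int_R: "integrable unif (R f)" and integral_R: "(\<integral>s. R f s \<partial>unif) = (\<integral>t. f t \<partial>unif)"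
    if [measurable]: "f \<in> borel_measurable borel" and "integrable unif f" for f
  proof -
    have ae: "AE t in unif. f t = \<bar>x t\<bar> * (f t / \<bar>x t\<bar>)"
      using nz by eventually_elim simp
    have "integrable unif (\<lambda>t. \<bar>x t\<bar> * (f t / \<bar>x t\<bar>))"
      using that(2) ae by (subst (asm) integrable_cong_AE) auto
    then show "integrable unif (R f)"
      unfolding R_def using int_q[of "\<lambda>t. f t / \<bar>x t\<bar>"] by simp
    have "(\<integral>t. f t \<partial>unif) = (\<integral>t. \<bar>x t\<bar> * (f t / \<bar>x t\<bar>) \<partial>unif)"
      using ae by (intro integral_cong_AE) auto
    then show "(\<integral>s. R f s \<partial>unif) = (\<integral>t. f t \<partial>unif)"
      unfolding R_def using integral_q[of "\<lambda>t. f t / \<bar>x t\<bar>"] by simp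
  qed
  define T where "T Z = abs_L1 (R (SOME f. represents f Z))" for Z
  have T: "represents (R f) (T Z)" if f: "represents f Z" for f Z
  proof -
    define g where "g = (SOME h. represents h Z)"
    have g: "represents g Z"
      unfolding g_def
      by (rule someI[of "\<lambda>h. represents h Z", OF f])
    note [measurable] = representsD(1)[OF f] representsD(1)[OF g]
    have "AE t in unif. g t = f t"
      using represents_eq_iff[OF g f] by simp
    then have "AE s in unif. g (q s) = f (q s)"
      by (rule AE_q) measurable
    then have "AE s in unif. R g s = R f s"
      by eventually_elim (simp add: R_def)
    moreover have "T Z = abs_L1 (R g)"
      by (simp only: T_def g_def)
    then have "represents (R g) (T Z)"
      using representsD(1,2)[OF g] by (simp add: represents_def int_R)
    moreover have "represents (R f) (abs_L1 (R f))"
      using representsD(1,2)[OF f] by (simp add: represents_def int_R)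
    ultimately have "T Z = abs_L1 (R f)"
      using represents_eq_iff[of "R g" "T Z" "R f" "abs_L1 (R f)"] by simp
    then show ?thesis
      using \<open>represents (R f) (abs_L1 (R f))\<close> by simp
  qed
  have norm_T: "norm (T Z) = norm Z" and integral_T: "L1_integral (T Z) = L1_integral Z" for Z
  proof -
    obtain f where f: "represents f Z"
      using represents_exists by blast
    have "(\<integral>s. \<bar>R f s\<bar> \<partial>unif) = (\<integral>s. R (\<lambda>t. \<bar>f t\<bar>) s \<partial>unif)"
      by (simp add: R_def abs_divide)
    then show "norm (T Z) = norm Z"
      using integral_R[of "\<lambda>t. \<bar>f t\<bar>"] representsD(1,2)[OF f]
      by (simp add: represents_norm[OF T[OF f]] represents_norm[OF f])
    show "L1_integral (T Z) = L1_integral Z"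
      using representsD(1,2)[OF f]
      by (simp add: represents_integral[OF T[OF f]] represents_integral[OF f] integral_R)
  qed
  have T_add: "T (Z + W) = T Z + T W" for Z W
  proof -
    obtain f g where f: "represents f Z" and g: "represents g W"
      using represents_exists by metis
    show ?thesis
      using represents_eq_iff[OF T[OF represents_add[OF f g]] represents_add[OF T[OF f] T[OF g]]]
      by (simp add: R_def add_divide_distrib)
  qed
  have T_scaleR: "T (c *\<^sub>R Z) = c *\<^sub>R T Z" for c Z
  proof -
    obtain f where f: "represents f Z"
      using represents_exists by blast
    show ?thesis
      using represents_eq_iff[OF T[OF represents_scaleR[OF f]] represents_scaleR[OF T[OF f]], of c c]
      by (simp add: R_def)
  qed
  \<comment> \<open>The left inverse \<open>\<psi>\<close> of \<open>q\<close> gives the preimage \<open>|x| (g \<circ> \<psi>)\<close> of \<open>g\<close>.\<close>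
  have T_surj: "\<exists>Z. T Z = Y" for Y
  proof -
    obtain g where g: "represents g Y"
      using represents_exists by blast
    note [measurable] = representsD(1)[OF g]
    define f where "f t = \<bar>x t\<bar> * g (\<psi> t)" for t
    have [measurable]: "f \<in> borel_measurable borel"
      unfolding f_def by measurable
    have ae: "AE s in unif. g (\<psi> (q s)) = g s"
      using \<psi>q by eventually_elim simp
    have "integrable unif (\<lambda>s. g (\<psi> (q s)))"
      using representsD(2)[OF g] ae by (subst integrable_cong_AE[of _ _ g]) auto
    then have "integrable unif f"
      using int_q[of "\<lambda>t. g (\<psi> t)"] by (simp add: f_def[abs_def])
    then have f: "represents f (abs_L1 f)"
      by (simp add: represents_def)
    have "AE s in unif. R f s = g s"
      using \<psi>q nzq by eventually_elim (simp add: R_def f_def)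
    then have "T (abs_L1 f) = Y"
      using represents_eq_iff[OF T[OF f] g] by simp
    then show ?thesis ..
  qed
  have "T ` M1 = M1"
  proof (intro set_eqI iffI)
    show "Y \<in> M1" if "Y \<in> T ` M1" for Y
      using that integral_T by (auto simp: M1_def)
    show "Y \<in> T ` M1" if Y: "Y \<in> M1" for Y
    proof -
      obtain Z where Z: "T Z = Y"
        using T_surj by blast
      then have "Z \<in> M1"
        using Y integral_T[of Z] by (simp add: M1_def)
      then show ?thesis
        using Z by (intro image_eqI[of _ _ Z]) simp_all
    qed
  qed
  then have "T \<in> isometric_automorphisms M1"
    by (simp add: isometric_automorphisms_def T_add T_scaleR norm_T)
  moreover have "T X = abs_L1 half_sign"
  proof -
    have "AE s in unif. R x s = half_sign s"
      using xq nzq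
    proof eventually_elim
      case (elim s)
      have "R x s = \<bar>x (q s)\<bar> * half_sign s / \<bar>x (q s)\<bar>"
        unfolding R_def by (rule arg_cong[OF elim(1), of "\<lambda>u. u / \<bar>x (q s)\<bar>"])
      then show ?case
        using elim(2) by simp
    qed
    moreover have "represents half_sign (abs_L1 half_sign)"
    proof -
      interpret prob_space unif by (rule prob_space_unif)
      have "integrable unif half_sign"
        by (rule integrable_const_bound[of _ 1]) (auto simp: half_sign_def)
      then show ?thesis
        by (simp add: represents_def)
    qed
    ultimately show ?thesis
      using represents_eq_iff[OF T[OF x]] by blast
  qed
  ultimately show ?thesis
    by blast
qed

section \<open>Almost transitivity\<close>

text \<open>
  Subtracting a small multiple \<open>a\<close> of \<open>half_sign\<close> keeps the mean zero and creates zeros only on the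
  level set at height \<open>a\<close> of \<open>x\<close> times \<open>half_sign\<close>, which is null for all but countably many \<open>a\<close>.
  Normalising afterwards moves the point by at most \<open>a\<close> again.
\<close>

lemma nonvanishing_dense:
  assumes X: "X \<in> unit_sphere M1" and "0 < \<epsilon>"
  obtains z Z where "represents z Z" "Z \<in> unit_sphere M1" "dist X Z < \<epsilon>" "AE t in unif. z t \<noteq> 0"
proof -
  interpret prob_space unif by (rule prob_space_unif)
  obtain x where x: "represents x X"
    using represents_exists by blast
  note [measurable] = representsD(1)[OF x]
  have int_h: "integrable unif half_sign"
    by (rule integrable_const_bound[of _ 1]) (auto simp: half_sign_def)
  define H where "H = abs_L1 half_sign"
  have H: "represents half_sign H"
    using int_h by (simp add: represents_def H_def)
  have norm_H: "norm H = 1"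
  proof -
    have "(\<integral>t. \<bar>half_sign t\<bar> \<partial>unif) = (\<integral>t. 1 \<partial>unif)"
      by (intro Bochner_Integration.integral_cong) (auto simp: half_sign_def)
    then show ?thesis
      using represents_norm[OF H] prob_space by simp
  qed
  have mean_H: "H \<in> M1"
  proof -
    have "measure unif {..1/2} = measure lborel ({0<..<1} \<inter> {..1/2 :: real})"
      by (simp add: measure_def emeasure_unif)
    also have "{0<..<1} \<inter> {..1/2} = {0<..1/2 :: real}"
      by auto
    finally have half: "measure unif {..1/2} = 1/2"
      by simp
    have "(\<integral>t. half_sign t \<partial>unif) = (\<integral>t. 2 * indicator {..1/2} t - 1 \<partial>unif)"
      by (intro Bochner_Integration.integral_cong) (auto simp: half_sign_def)
    also have "\<dots> = 2 * measure unif {..1/2} - 1"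
      using prob_space by (subst Bochner_Integration.integral_diff) (auto simp: less_top[symmetric])
    also have "\<dots> = 0"
      by (simp add: half)
    finally show ?thesis
      using represents_integral[OF H] by (simp add: M1_def)
  qed
  define D where "D = distr unif borel (\<lambda>t. x t * half_sign t)"
  interpret D: prob_space D
    unfolding D_def by (rule prob_space_distr) measurable
  \<comment> \<open>Half of \<open>\<epsilon>\<close> for each of the two moves; the bound \<open>1/2\<close> keeps the perturbed point away from \<open>0\<close>.\<close>
  define \<delta> where "\<delta> = min (\<epsilon> / 2) (1/2)"
  have "0 < \<delta>"
    using \<open>0 < \<epsilon>\<close> by (simp add: \<delta>_def)
  then obtain a where a: "a \<in> {0<..<\<delta>}" "measure D {a} = 0"
    using open_minus_countable[OF D.countable_support, of "{0<..<\<delta>}"] by auto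
  define z where "z t = x t - a * half_sign t" for t
  define Z where "Z = X - a *\<^sub>R H"
  have z: "represents z Z"
    unfolding z_def Z_def by (intro represents_diff represents_scaleR x H)
  have "emeasure D {a} = 0"
    using a(2) by (simp add: D.emeasure_eq_measure)
  then have "AE u in D. u \<noteq> a"
    by (intro AE_I[of _ _ "{a}"]) (auto simp: D_def)
  then have "AE t in unif. x t * half_sign t \<noteq> a"
    unfolding D_def by (subst (asm) AE_distr_iff) auto
  then have nz: "AE t in unif. z t \<noteq> 0"
    by eventually_elim (auto simp: z_def half_sign_def split: if_splits)
  have X': "X \<in> M1" "norm X = 1"
    using X by (auto simp: unit_sphere_def)
  have "Z \<in> M1"
    unfolding Z_def by (intro subspace_diff[OF subspace_M1] subspace_scale[OF subspace_M1] X' mean_H)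
  have XZ: "norm (X - Z) = a"
    using a by (simp add: Z_def norm_H)
  then have "\<bar>1 - norm Z\<bar> \<le> a"
    using norm_triangle_ineq3[of X Z] X' by simp
  then have pos: "0 < norm Z"
    using a by (auto simp: \<delta>_def)
  have "Z - sgn Z = (1 - inverse (norm Z)) *\<^sub>R Z"
    by (simp add: sgn_div_norm algebra_simps)
  then have "norm (Z - sgn Z) = \<bar>1 - inverse (norm Z)\<bar> * norm Z"
    by simp
  also have "\<dots> = \<bar>(1 - inverse (norm Z)) * norm Z\<bar>"
    by (simp add: abs_mult)
  also have "(1 - inverse (norm Z)) * norm Z = norm Z - 1"
    using pos by (simp add: algebra_simps)
  finally have "norm (Z - sgn Z) \<le> a"
    using \<open>\<bar>1 - norm Z\<bar> \<le> a\<close> by linarith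
  then have "dist X (sgn Z) < \<epsilon>"
    using dist_triangle[of X "sgn Z" Z] XZ a by (simp add: dist_norm \<delta>_def)
  moreover have "represents (\<lambda>t. inverse (norm Z) * z t) (sgn Z)"
    unfolding sgn_div_norm by (rule represents_scaleR[OF z])
  moreover have "sgn Z \<in> unit_sphere M1"
    using \<open>Z \<in> M1\<close> pos subspace_scale[OF subspace_M1]
    by (auto simp: unit_sphere_def norm_sgn sgn_div_norm)
  moreover have "AE t in unif. inverse (norm Z) * z t \<noteq> 0"
    using nz by eventually_elim (use pos in auto)
  ultimately show thesis
    using that by blast
qed

theorem theorem3p1: "almost_transitive M1"
proof (rule almost_transitiveI[OF subspace_M1])
  fix X \<epsilon> assume "X \<in> unit_sphere M1" "0 < (\<epsilon>::real)"
  then obtain z Z where z: "represents z Z" "AE t in unif. z t \<noteq> 0"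
    and Z: "Z \<in> unit_sphere M1" "dist X Z < \<epsilon>"
    by (rule nonvanishing_dense)
  then obtain T where "T \<in> isometric_automorphisms M1" "T Z = abs_L1 half_sign"
    using nonvanishing_to_half_sign[OF z] by (auto simp: unit_sphere_def)
  then show "\<exists>X'\<in>M1. \<exists>T\<in>isometric_automorphisms M1. dist X X' < \<epsilon> \<and> T X' = abs_L1 half_sign"
    using Z by (auto simp: unit_sphere_def)
qed

end
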